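(* Let $v\ge2$, $\epsilon>0$, $n\ge1$. Let $(Q,\hat P_n)$ be a block design scheme with parameters $(v,b,r,k,\lambda,\epsilon)$ where $k\in K_{opt}(v,\epsilon)$, and let $(Q',\hat P_n')$ be any unbiased scheme whose mechanism $Q'$ is $\epsilon$-LDP. Then $$R^*_{v,n}(\ell_2^2,Q,\hat P_n)\le R^*_{v,n}(\ell_2^2,Q',\hat P_n').$$
   Context: $\mathcal{X}=\{1,\dots,v\}$, $\Delta_v$ the probability vectors on $\mathcal{X}$. A scheme is a pair $(Q,\hat P_n)$ of a conditional distribution $Q$ from $\mathcal{X}$ to an output set $\mathcal{Y}$ and an estimator $\hat P_n:\mathcal{Y}^n\to\mathbb{R}^v$; with $X_1,\dots,X_n$ i.i.d. $\sim P$ and $Y_i\sim Q(\cdot|X_i)$ independently, it is unbiased if $\mathbb{E}[\hat P_n(Y_1,\dots,Y_n)]=P$ for all $P\in\Delta_v$. $Q$ is $\epsilon$-LDP if $Q(A|x)\le e^\epsilon Q(A|x')$ for all $x,x'$ and measurable $A$. $R^*_{v,n}(\ell,Q,\hat P_n)=\sup_{P\in\Delta_v}\mathbb{E}[\ell(P,\hat P_n(Y_1,\dots,Y_n))]$, $\ell_2^2(p,\hat p)=\sum_x(p_x-\hat p_x)^2$. $K_{opt}(v,\epsilon)$ is the set of $k\in\{1,\dots,v-1\}$ minimizing $\frac{(ke^\epsilon+v-k)^2}{k(v-k)}$. For $\mathcal{I}\subset\mathcal{X}\times\mathcal{Y}$, $\mathcal{I}_x=\{y:(x,y)\in\mathcal{I}\}$,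 $\mathcal{I}^y=\{x:(x,y)\in\mathcal{I}\}$; for integers $v>k>0$, $b>r>\lambda\ge0$, a $(v,b,r,k,\lambda)$-block design has $|\mathcal{Y}|=b$, $|\mathcal{I}_x|=r$, $|\mathcal{I}^y|=k$, $|\mathcal{I}_x\cap\mathcal{I}_{x'}|=\lambda$ ($x\neq x'$). A block design scheme with parameters $(v,b,r,k,\lambda,\epsilon)$ uses such a design, $Q(y|x)=\alpha e^\epsilon$ if $(x,y)\in\mathcal{I}$ and $\alpha$ otherwise with $\alpha=1/(re^\epsilon+b-r)$, and $\hat P_{n,x}=\frac{1}{(r-\lambda)(e^\epsilon-1)}\left(\frac{N_x}{n\alpha}-(\lambda e^\epsilon+r-\lambda)\right)$, $N_x=\sum_{i=1}^n\mathbb{1}(Y_i\in\mathcal{I}_x)$. *)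

theory Defs
  imports "HOL-Probability.Probability"
begin

definition prob_vecs :: "nat \<Rightarrow> (nat \<Rightarrow> real) set" where
  "prob_vecs v = {P. (\<forall>x\<in>{1..v}. 0 \<le> P x) \<and> (\<Sum>x\<in>{1..v}. P x) = 1}"

definition input_dist :: "nat \<Rightarrow> (nat \<Rightarrow> real) \<Rightarrow> nat measure" where
  "input_dist v P = point_measure {1..v} (\<lambda>x. ennreal (P x))"

definition output_dist :: "nat \<Rightarrow> (nat \<Rightarrow> real) \<Rightarrow> (nat \<Rightarrow> 'c measure) \<Rightarrow> 'c measure" where
  "output_dist v P Q = input_dist v P \<bind> Q"

text \<open>Joint law of (Y_1,...,Y_n) (indexed by 0..<n), the pairs (X_i,Y_i) being i.i.d.\<close>
definition sample_dist :: "nat \<Rightarrow> nat \<Rightarrow> (nat \<Rightarrow> real) \<Rightarrow> (nat \<Rightarrow> 'c measure) \<Rightarrow> (nat \<Rightarrow> 'c) measure" where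
  "sample_dist v n P Q = PiM {..<n} (\<lambda>_. output_dist v P Q)"

definition mechanism :: "nat \<Rightarrow> (nat \<Rightarrow> 'c measure) \<Rightarrow> 'c measure \<Rightarrow> bool" where
  "mechanism v Q N \<longleftrightarrow> (\<forall>x\<in>{1..v}. prob_space (Q x) \<and> sets (Q x) = sets N)"

definition LDP :: "nat \<Rightarrow> real \<Rightarrow> (nat \<Rightarrow> 'c measure) \<Rightarrow> 'c measure \<Rightarrow> bool" where
  "LDP v \<epsilon> Q N \<longleftrightarrow> (\<forall>x\<in>{1..v}. \<forall>x'\<in>{1..v}. \<forall>A\<in>sets N.
      measure (Q x) A \<le> exp \<epsilon> * measure (Q x') A)"

text \<open>Estimators map a sample (Y_0..Y_{n-1}) to a vector in R^v (coordinates 1..v).\<close>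
definition unbiased :: "nat \<Rightarrow> nat \<Rightarrow> (nat \<Rightarrow> 'c measure) \<Rightarrow> ((nat \<Rightarrow> 'c) \<Rightarrow> nat \<Rightarrow> real) \<Rightarrow> bool" where
  "unbiased v n Q Phat \<longleftrightarrow> (\<forall>P\<in>prob_vecs v. \<forall>x\<in>{1..v}.
      integrable (sample_dist v n P Q) (\<lambda>ys. Phat ys x) \<and>
      (\<integral>ys. Phat ys x \<partial>sample_dist v n P Q) = P x)"

definition l2sq :: "nat \<Rightarrow> (nat \<Rightarrow> real) \<Rightarrow> (nat \<Rightarrow> real) \<Rightarrow> real" where
  "l2sq v p q = (\<Sum>x\<in>{1..v}. (p x - q x)^2)"

definition risk_l2sq :: "nat \<Rightarrow> nat \<Rightarrow> (nat \<Rightarrow> 'c measure) \<Rightarrow> ((nat \<Rightarrow> 'c) \<Rightarrow> nat \<Rightarrow> real) \<Rightarrow> ennreal" where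
  "risk_l2sq v n Q Phat = (SUP P\<in>prob_vecs v. \<integral>\<^sup>+ ys. ennreal (l2sq v P (Phat ys)) \<partial>sample_dist v n P Q)"

definition K_opt :: "nat \<Rightarrow> real \<Rightarrow> nat set" where
  "K_opt v \<epsilon> = {k \<in> {1..v-1}. \<forall>k'\<in>{1..v-1}.
     (real k * exp \<epsilon> + real v - real k)^2 / (real k * (real v - real k))
     \<le> (real k' * exp \<epsilon> + real v - real k')^2 / (real k' * (real v - real k'))}"

definition block_design :: "nat \<Rightarrow> nat \<Rightarrow> nat \<Rightarrow> nat \<Rightarrow> nat \<Rightarrow> 'b set \<Rightarrow> (nat \<times> 'b) set \<Rightarrow> bool" where
  "block_design v b r k lam Y I \<longleftrightarrow>
     v > k \<and> k > 0 \<and> b > r \<and> r > lam \<and>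
     finite Y \<and> card Y = b \<and> I \<subseteq> {1..v} \<times> Y \<and>
     (\<forall>x\<in>{1..v}. card {y. (x,y) \<in> I} = r) \<and>
     (\<forall>y\<in>Y. card {x. (x,y) \<in> I} = k) \<and>
     (\<forall>x\<in>{1..v}. \<forall>x'\<in>{1..v}. x \<noteq> x' \<longrightarrow> card ({y. (x,y) \<in> I} \<inter> {y. (x',y) \<in> I}) = lam)"

definition bd_alpha :: "nat \<Rightarrow> nat \<Rightarrow> real \<Rightarrow> real" where
  "bd_alpha b r \<epsilon> = 1 / (real r * exp \<epsilon> + real b - real r)"

definition bd_Q :: "nat \<Rightarrow> nat \<Rightarrow> real \<Rightarrow> 'b set \<Rightarrow> (nat \<times> 'b) set \<Rightarrow> nat \<Rightarrow> 'b measure" where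
  "bd_Q b r \<epsilon> Y I x = point_measure Y
     (\<lambda>y. ennreal (if (x,y) \<in> I then bd_alpha b r \<epsilon> * exp \<epsilon> else bd_alpha b r \<epsilon>))"

definition bd_est :: "nat \<Rightarrow> nat \<Rightarrow> nat \<Rightarrow> nat \<Rightarrow> real \<Rightarrow> (nat \<times> 'b) set \<Rightarrow> (nat \<Rightarrow> 'b) \<Rightarrow> nat \<Rightarrow> real" where
  "bd_est n b r lam \<epsilon> I ys x =
     (let N = real (card {i\<in>{..<n}. (x, ys i) \<in> I}) in
      1 / ((real r - real lam) * (exp \<epsilon> - 1)) *
      (N / (real n * bd_alpha b r \<epsilon>) - (real lam * exp \<epsilon> + real r - real lam)))"

end

theory Submission
  imports Defs
begin

text \<open>
  Both risks are compared with
  \<open>(v - 1)\<^sup>2 (k e\<^sup>\<epsilon> + v - k)\<^sup>2 / (n v k (v - k) (e\<^sup>\<epsilon> - 1)\<^sup>2)\<close>.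
  For an unbiased scheme, a Cramer--Rao argument at the uniform distribution bounds the risk below by
  \<open>(v - 1)\<^sup>2 / (n J)\<close>, where \<open>J = E \<Sum>\<^sub>x (q\<^sub>x - 1)\<^sup>2\<close> and \<open>q\<^sub>x\<close> is the density of \<open>Q(\<cdot>|x)\<close> with
  respect to the uniform mixture. Pointwise, the \<open>q\<^sub>x\<close> sum to \<open>v\<close> and have ratios at most \<open>e\<^sup>\<epsilon>\<close>; a
  function convex in every coordinate is maximal at a vertex, so \<open>J\<close> is largest for a density taking two
  values with ratio \<open>e\<^sup>\<epsilon>\<close>, the larger one on \<open>k\<close> symbols, and the best \<open>k\<close> is the one in \<open>K_opt\<close>.
  For the block design scheme the risk at \<open>P\<close> is a sum of binomial variances whose success probabilities
  add up to \<open>k\<close>, hence is at most its value when they are all equal.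
\<close>

subsection \<open>Outputs of a mechanism, densities and product measures\<close>

lemma mechanism_measurable:
  assumes "mechanism v Q N"
  shows "Q \<in> measurable (input_dist v P) (subprob_algebra N)"
  using assms unfolding input_dist_def mechanism_def measurable_point_measure_eq1
  by (auto simp: space_subprob_algebra intro: prob_space_imp_subprob_space)

lemma prob_vecs_imp_pos: "P \<in> prob_vecs v \<Longrightarrow> 1 \<le> v"
  by (cases v) (auto simp: prob_vecs_def)

text \<open>With \<open>1 \<le> v\<close> the input space is nonempty; over an empty space
  \<open>bind\<close> returns the empty measure and forgets the sets of \<open>N\<close>.\<close>

lemma sets_output_dist:
  assumes "mechanism v Q N" "1 \<le> v"
  shows "sets (output_dist v P Q) = sets N"
  unfolding output_dist_def
  using assms by (intro sets_bind) (auto simp: input_dist_def space_point_measure mechanism_def)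

lemma emeasure_output_dist:
  assumes "mechanism v Q N" "1 \<le> v" "A \<in> sets N"
  shows "emeasure (output_dist v P Q) A = (\<Sum>x\<in>{1..v}. ennreal (P x) * emeasure (Q x) A)"
proof -
  have "emeasure (output_dist v P Q) A = (\<integral>\<^sup>+x. emeasure (Q x) A \<partial>input_dist v P)"
    unfolding output_dist_def using assms
    by (intro emeasure_bind[OF _ mechanism_measurable]) (auto simp: input_dist_def space_point_measure)
  then show ?thesis
    by (simp add: input_dist_def nn_integral_point_measure_finite)
qed

lemma measure_output_dist:
  assumes "mechanism v Q N" "P \<in> prob_vecs v" "A \<in> sets N"
  shows "measure (output_dist v P Q) A = (\<Sum>x\<in>{1..v}. P x * measure (Q x) A)"
proof -
  have "emeasure (output_dist v P Q) A = (\<Sum>x\<in>{1..v}. ennreal (P x * measure (Q x) A))"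
    unfolding emeasure_output_dist[OF assms(1) prob_vecs_imp_pos[OF assms(2)] assms(3)]
    using assms by (intro sum.cong) (auto simp: prob_vecs_def mechanism_def prob_space_def
        finite_measure.emeasure_eq_measure ennreal_mult')
  also have "\<dots> = ennreal (\<Sum>x\<in>{1..v}. P x * measure (Q x) A)"
    using assms by (intro sum_ennreal) (auto simp: prob_vecs_def)
  finally have "emeasure (output_dist v P Q) A = ennreal (\<Sum>x\<in>{1..v}. P x * measure (Q x) A)" .
  then show ?thesis
    using assms by (auto simp: measure_def prob_vecs_def intro!: enn2real_ennreal sum_nonneg)
qed

lemma prob_space_output_dist:
  assumes "mechanism v Q N" "P \<in> prob_vecs v"
  shows "prob_space (output_dist v P Q)"
proof
  have v: "1 \<le> v" using prob_vecs_imp_pos assms by blast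
  have sp: "space (output_dist v P Q) = space N"
    using sets_output_dist[OF assms(1) v] by (rule sets_eq_imp_space_eq)
  have 1: "emeasure (Q x) (space N) = 1" if "x \<in> {1..v}" for x
    using assms(1) that prob_space.emeasure_space_1[of "Q x"] sets_eq_imp_space_eq[of "Q x" N]
    by (auto simp: mechanism_def)
  have "emeasure (output_dist v P Q) (space N) = (\<Sum>x\<in>{1..v}. ennreal (P x))"
    by (subst emeasure_output_dist[OF assms(1) v]) (auto intro!: sum.cong simp: 1)
  also have "\<dots> = 1"
    using assms(2) by (subst sum_ennreal) (auto simp: prob_vecs_def)
  finally show "emeasure (output_dist v P Q) (space (output_dist v P Q)) = 1"
    by (simp add: sp)
qed

section \<open>Densities with respect to a dominating probability measure\<close>

text \<open>Test the hypothesis on the set where \<open>f\<close> exceeds \<open>g\<close>: there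
  the difference is nonnegative with nonpositive integral, so it vanishes almost everywhere. This
  turns setwise conditions such as \<open>LDP\<close> into pointwise conditions on
  densities.\<close>

lemma AE_le_of_set_integral_le:
  fixes f g :: "'a \<Rightarrow> real"
  assumes f: "integrable M f" and g: "integrable M g"
    and le: "\<And>A. A \<in> sets M \<Longrightarrow> (\<integral>y. f y * indicator A y \<partial>M) \<le> (\<integral>y. g y * indicator A y \<partial>M)"
  shows "AE y in M. f y \<le> g y"
proof -
  note [measurable] = borel_measurable_integrable[OF f] borel_measurable_integrable[OF g]
  define A where "A = {y \<in> space M. g y < f y}"
  have [measurable]: "A \<in> sets M" unfolding A_def by measurable
  have If: "integrable M (\<lambda>y. f y * indicator A y)" and Ig: "integrable M (\<lambda>y. g y * indicator A y)"
    using f g by (auto intro: integrable_real_mult_indicator)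
  let ?h = "\<lambda>y. f y * indicator A y - g y * indicator A y"
  have nn: "0 \<le> ?h y" for y by (auto simp: A_def indicator_def)
  have "integral\<^sup>L M ?h \<le> 0"
    using le[of A] If Ig by simp
  moreover have "0 \<le> integral\<^sup>L M ?h" using nn by simp
  ultimately have "AE y in M. ?h y = 0"
    using nn If Ig by (subst integral_nonneg_eq_0_iff_AE[symmetric]) auto
  with AE_space show ?thesis
    by eventually_elim (auto simp: A_def indicator_def split: if_splits)
qed

lemma measure_density_real:
  fixes q :: "'a \<Rightarrow> real"
  assumes "q \<in> borel_measurable M" "\<And>y. 0 \<le> q y" "integrable M q" "A \<in> sets M"
  shows "measure (density M q) A = (\<integral>y. q y * indicator A y \<partial>M)"
proof -
  have "emeasure (density M q) A = (\<integral>\<^sup>+y. ennreal (q y * indicator A y) \<partial>M)"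
    using assms by (subst emeasure_density) (auto intro!: nn_integral_cong simp: indicator_def)
  also have "\<dots> = ennreal (\<integral>y. q y * indicator A y \<partial>M)"
    using assms by (intro nn_integral_eq_integral integrable_real_mult_indicator) auto
  finally show ?thesis
    using assms by (simp add: measure_def)
qed

text \<open>Radon-Nikodym, with the derivative altered on a null set so that the bounds hold
  everywhere. A bounded density makes all later moments integrable without further work.\<close>

lemma bounded_density_exists:
  fixes c :: real
  assumes M: "prob_space M" and K: "prob_space K" and sets: "sets K = sets M"
    and le: "\<And>A. A \<in> sets M \<Longrightarrow> measure K A \<le> c * measure M A"
  obtains q :: "'a \<Rightarrow> real" where "q \<in> borel_measurable M" "\<And>y. 0 \<le> q y" "\<And>y. q y \<le> c"
    "K = density M q"
proof -
  interpret M: prob_space M by fact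
  interpret K: prob_space K by fact
  have [simp]: "space K = space M" using sets by (rule sets_eq_imp_space_eq)
  have c: "0 \<le> c" using le[of "space M"] K.prob_space M.prob_space by simp
  have ac: "absolutely_continuous M K"
    unfolding absolutely_continuous_def
  proof
    fix A assume A: "A \<in> null_sets M"
    then have "measure K A \<le> 0" using le[of A] by (auto simp: measure_eq_0_null_sets null_setsD2)
    then show "A \<in> null_sets K"
      using A sets by (auto simp: null_sets_def K.emeasure_eq_measure measure_nonneg antisym)
  qed
  define f where "f = RN_deriv M K"
  have [measurable]: "f \<in> borel_measurable M" by (simp add: f_def)
  have fin: "AE y in M. f y \<noteq> \<infinity>"
    unfolding f_def
    by (rule M.RN_deriv_finite[OF _ ac sets]) (rule K.sigma_finite_measure)
  \<comment> \<open>\<open>enn2real\<close> sends infinity to 0, which changes the derivative only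
    on a null set by \<open>fin\<close>.\<close>
  define q0 where "q0 y = enn2real (f y)" for y
  have [measurable]: "q0 \<in> borel_measurable M" unfolding q0_def by measurable
  have K0: "K = density M q0"
  proof -
    have "K = density M f" unfolding f_def using M.density_RN_deriv[OF ac sets] by simp
    also have "\<dots> = density M q0"
      using fin by (intro density_cong) (auto simp: q0_def elim!: eventually_mono simp: less_top)
    finally show ?thesis .
  qed
  have q0: "0 \<le> q0 y" for y by (simp add: q0_def)
  have Iq0: "integrable M q0"
  proof (rule integrableI_nonneg)
    have "(\<integral>\<^sup>+y. ennreal (q0 y) \<partial>M) = emeasure K (space M)"
      unfolding K0 by (subst emeasure_density) (auto intro!: nn_integral_cong)
    then show "(\<integral>\<^sup>+y. ennreal (q0 y) \<partial>M) < \<infinity>"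
      using K.emeasure_space_1 by simp
  qed (auto simp: q0)
  have "AE y in M. q0 y \<le> c"
  proof (rule AE_le_of_set_integral_le[OF Iq0])
    fix A assume A: "A \<in> sets M"
    have "(\<integral>y. q0 y * indicator A y \<partial>M) = measure K A"
      unfolding K0 using A q0 Iq0 by (subst measure_density_real) auto
    also have "\<dots> \<le> (\<integral>y. c * indicator A y \<partial>M)" using le[OF A] A by simp
    finally show "(\<integral>y. q0 y * indicator A y \<partial>M) \<le> (\<integral>y. c * indicator A y \<partial>M)" .
  qed simp
  \<comment> \<open>Truncating at \<open>c\<close> leaves the density unchanged almost
    everywhere.\<close>
  then have "K = density M (\<lambda>y. min (q0 y) c)"
    unfolding K0 by (intro density_cong) (auto elim!: eventually_mono simp: min_def)
  with q0 c show ?thesis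
    by (intro that[of "\<lambda>y. min (q0 y) c"]) auto
qed

section \<open>Likelihood ratios and second moments under product measures\<close>

text \<open>A product measure is determined by its values on boxes, and on a box both the indicator
  and the density factor over the coordinates.\<close>

lemma PiM_density_prod:
  fixes g :: "'a \<Rightarrow> real" and n :: nat
  assumes M: "prob_space M" and D: "prob_space (density M g)"
    and [measurable]: "g \<in> borel_measurable M" and g: "\<And>y. 0 \<le> g y"
  shows "PiM {..<n} (\<lambda>_. density M g) = density (PiM {..<n} (\<lambda>_. M)) (\<lambda>ys. ennreal (\<Prod>i<n. g (ys i)))"
proof -
  interpret M: prob_space M by fact
  interpret D: prob_space "density M g" by fact
  interpret P: product_sigma_finite "\<lambda>_::nat. M" by standard
  interpret R: product_sigma_finite "\<lambda>_::nat. density M g" by standard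
  have "density (PiM {..<n} (\<lambda>_. M)) (\<lambda>ys. ennreal (\<Prod>i<n. g (ys i))) = PiM {..<n} (\<lambda>_. density M g)"
  proof (rule R.PiM_eqI)
    fix A assume A: "\<And>i. i \<in> {..<n} \<Longrightarrow> A i \<in> sets (density M g)"
    then have A': "\<And>i. i \<in> {..<n} \<Longrightarrow> A i \<in> sets M" by simp
    have "emeasure (density (PiM {..<n} (\<lambda>_. M)) (\<lambda>ys. ennreal (\<Prod>i<n. g (ys i)))) (Pi\<^sub>E {..<n} A) =
      (\<integral>\<^sup>+ys. ennreal (\<Prod>i<n. g (ys i)) * indicator (Pi\<^sub>E {..<n} A) ys \<partial>PiM {..<n} (\<lambda>_. M))"
      using A' by (intro emeasure_density) (auto intro!: sets_PiM_I_finite)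
    also have "\<dots> = (\<integral>\<^sup>+ys. (\<Prod>i<n. ennreal (g (ys i)) * indicator (A i) (ys i)) \<partial>PiM {..<n} (\<lambda>_. M))"
    proof (rule nn_integral_cong)
      fix ys assume "ys \<in> space (PiM {..<n} (\<lambda>_. M))"
      \<comment> \<open>Membership in \<open>Pi\<^sub>E\<close> also requires extensionality;
        without it the box indicator would not be the product of the coordinate indicators.\<close>
      then have ext: "ys \<in> extensional {..<n}" by (auto simp: space_PiM PiE_def)
      show "ennreal (\<Prod>i<n. g (ys i)) * indicator (Pi\<^sub>E {..<n} A) ys =
          (\<Prod>i<n. ennreal (g (ys i)) * indicator (A i) (ys i))"
      proof (cases "ys \<in> Pi\<^sub>E {..<n} A")
        case True
        then have "(\<Prod>i<n. ennreal (g (ys i)) * indicator (A i) (ys i)) = (\<Prod>i<n. ennreal (g (ys i)))"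
          by (intro prod.cong) (auto simp: PiE_def Pi_def)
        with True g show ?thesis by (simp add: prod_ennreal)
      next
        case False
        with ext obtain i where "i < n" "ys i \<notin> A i" by (auto simp: PiE_def Pi_def)
        then have "(\<Prod>i<n. ennreal (g (ys i)) * indicator (A i) (ys i)) = 0"
          by (intro prod_zero bexI[of _ i]) auto
        with False show ?thesis by simp
      qed
    qed
    also have "\<dots> = (\<Prod>i<n. \<integral>\<^sup>+y. ennreal (g y) * indicator (A i) y \<partial>M)"
      using A' by (intro P.product_nn_integral_prod) auto
    also have "\<dots> = (\<Prod>i<n. emeasure (density M g) (A i))"
      using A' by (intro prod.cong) (auto simp: emeasure_density)
    finally show "emeasure (density (PiM {..<n} (\<lambda>_. M)) (\<lambda>ys. ennreal (\<Prod>i<n. g (ys i)))) (Pi\<^sub>E {..<n} A) =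
      (\<Prod>i\<in>{..<n}. emeasure (density M g) (A i))" .
  qed (auto intro!: sets_PiM_cong)
  then show ?thesis by simp
qed

text \<open>\<open>L\<close> is a product of independent factors of mean 1, so its second moment is
  the \<open>n\<close>-th power of that of \<open>g\<close>. The last quantity is the chi-square
  divergence between the two product laws.\<close>

lemma likelihood_ratio_moments:
  fixes g :: "'a \<Rightarrow> real" and n :: nat
  assumes M: "prob_space M" and g: "integrable M g" "integral\<^sup>L M g = 1"
    and g2: "integrable M (\<lambda>y. (g y)\<^sup>2)"
  defines "L \<equiv> \<lambda>ys. \<Prod>i<n. g (ys i)"
  shows "integrable (PiM {..<n} (\<lambda>_. M)) L"
    and "integrable (PiM {..<n} (\<lambda>_. M)) (\<lambda>ys. (L ys - 1)\<^sup>2)"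
    and "(\<integral>ys. (L ys - 1)\<^sup>2 \<partial>PiM {..<n} (\<lambda>_. M)) = (\<integral>y. (g y)\<^sup>2 \<partial>M) ^ n - 1"
proof -
  interpret M: prob_space M by fact
  interpret P: product_prob_space "\<lambda>_::nat. M" "{..<n}" by standard
  have L: "integrable (PiM {..<n} (\<lambda>_. M)) L" "integral\<^sup>L (PiM {..<n} (\<lambda>_. M)) L = 1"
    unfolding L_def using g by (auto intro!: P.product_integrable_prod simp: P.product_integral_prod[of "{..<n}" "\<lambda>_. g"])
  have L2: "integrable (PiM {..<n} (\<lambda>_. M)) (\<lambda>ys. (L ys)\<^sup>2)"
      "(\<integral>ys. (L ys)\<^sup>2 \<partial>PiM {..<n} (\<lambda>_. M)) = (\<integral>y. (g y)\<^sup>2 \<partial>M) ^ n"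
    unfolding L_def prod_power_distrib using g2
      P.product_integrable_prod[of "{..<n}" "\<lambda>_ y. (g y)\<^sup>2"]
      P.product_integral_prod[of "{..<n}" "\<lambda>_ y. (g y)\<^sup>2"] by simp_all
  have eq: "(L ys - 1)\<^sup>2 = (L ys)\<^sup>2 - 2 * L ys + 1" for ys by (simp add: power2_eq_square algebra_simps)
  show "integrable (PiM {..<n} (\<lambda>_. M)) L" by (rule L)
  show "integrable (PiM {..<n} (\<lambda>_. M)) (\<lambda>ys. (L ys - 1)\<^sup>2)"
    unfolding eq using L L2 by auto
  show "(\<integral>ys. (L ys - 1)\<^sup>2 \<partial>PiM {..<n} (\<lambda>_. M)) = (\<integral>y. (g y)\<^sup>2 \<partial>M) ^ n - 1"
    unfolding eq using L L2 prob_space.prob_space[OF prob_space_PiM[of "{..<n}" "\<lambda>_. M"]] M by simp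
qed

text \<open>Expand the square: the off-diagonal terms vanish by independence and centring, and the
  \<open>n\<close> diagonal terms are equal.\<close>

lemma second_moment_sum_PiM:
  fixes f :: "'a \<Rightarrow> real" and n :: nat
  assumes M: "prob_space M" and f: "integrable M f" "integral\<^sup>L M f = 0"
    and f2: "integrable M (\<lambda>y. (f y)\<^sup>2)"
  shows "integrable (PiM {..<n} (\<lambda>_. M)) (\<lambda>ys. (\<Sum>i<n. f (ys i))\<^sup>2)" (is ?th1)
    and "(\<integral>ys. (\<Sum>i<n. f (ys i))\<^sup>2 \<partial>PiM {..<n} (\<lambda>_. M)) = n * (\<integral>y. (f y)\<^sup>2 \<partial>M)" (is ?th2)
proof -
  interpret M: prob_space M by fact
  interpret P: product_prob_space "\<lambda>_::nat. M" "{..<n}" by standard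
  \<comment> \<open>Writes \<open>f (ys i) * f (ys j)\<close> as a product over all coordinates,
    covering \<open>i = j\<close> and \<open>i \<noteq> j\<close> at once, so that the product
    formula for integrals applies.\<close>
  define h where "h i j m y = (if m = i then f y else 1) * (if m = j then f y else 1)" for i j m :: nat and y
  have hI: "integrable M (h i j m)" for i j m
    unfolding h_def[abs_def] using f f2 by (cases "m = i"; cases "m = j") (auto simp: power2_eq_square)
  have prod: "(\<Prod>m<n. h i j m (ys m)) = f (ys i) * f (ys j)" if "i < n" "j < n" for i j ys
    unfolding h_def prod.distrib using that by simp
  have I: "integrable (PiM {..<n} (\<lambda>_. M)) (\<lambda>ys. f (ys i) * f (ys j))" if "i < n" "j < n" for i j
    using P.product_integrable_prod[of "{..<n}" "h i j"] hI prod[OF that] by simp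
  have E: "(\<integral>ys. f (ys i) * f (ys j) \<partial>PiM {..<n} (\<lambda>_. M)) = (if i = j then \<integral>y. (f y)\<^sup>2 \<partial>M else 0)"
    if "i < n" "j < n" for i j
  proof -
    have "(\<integral>ys. f (ys i) * f (ys j) \<partial>PiM {..<n} (\<lambda>_. M)) = (\<Prod>m<n. integral\<^sup>L M (h i j m))"
      using P.product_integral_prod[of "{..<n}" "h i j"] hI prod[OF that] by simp
    also have "\<dots> = (if i = j then \<integral>y. (f y)\<^sup>2 \<partial>M else 0)"
    proof (cases "i = j")
      case True
      have "integral\<^sup>L M (h i j m) = (if m = i then \<integral>y. (f y)\<^sup>2 \<partial>M else 1)" for m
        using True M.prob_space by (auto simp: h_def[abs_def] power2_eq_square)
      with True that show ?thesis by simp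
    next
      case False
      then have "integral\<^sup>L M (h i j i) = 0"
        using f by (simp add: h_def[abs_def])
      with False that show ?thesis by (auto intro!: prod_zero)
    qed
    finally show ?thesis .
  qed
  have sq: "(\<Sum>i<n. f (ys i))\<^sup>2 = (\<Sum>i<n. \<Sum>j<n. f (ys i) * f (ys j))" for ys
    by (simp add: power2_eq_square sum_product)
  show ?th1 unfolding sq using I by (intro Bochner_Integration.integrable_sum) auto
  have "(\<integral>ys. (\<Sum>i<n. \<Sum>j<n. f (ys i) * f (ys j)) \<partial>PiM {..<n} (\<lambda>_. M))
      = (\<Sum>i<n. \<Sum>j<n. \<integral>ys. f (ys i) * f (ys j) \<partial>PiM {..<n} (\<lambda>_. M))"
    using I by (subst Bochner_Integration.integral_sum, (intro Bochner_Integration.integrable_sum)?)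
      (auto intro!: sum.cong Bochner_Integration.integral_sum)
  also have "\<dots> = n * (\<integral>y. (f y)\<^sup>2 \<partial>M)"
    using E by simp
  finally show ?th2 unfolding sq .
qed

subsection \<open>Extremal two-level vectors\<close>

text \<open>The difference of the two sides is a quadratic in \<open>t\<close> with leading
  coefficient \<open>1 - c \<ge> 0\<close>, hence convex, and its maximum over \<open>[1, E]\<close>
  is at an endpoint.\<close>

lemma convex_quadratic_le_endpoints:
  fixes a c t u E :: real
  assumes "c \<le> 1" "1 \<le> t" "t \<le> E"
    and "a + 1 \<le> c * (u + 1)\<^sup>2" "a + E\<^sup>2 \<le> c * (u + E)\<^sup>2"
  shows "a + t\<^sup>2 \<le> c * (u + t)\<^sup>2"
proof (cases "E = 1")
  case True
  with assms show ?thesis by (simp add: antisym)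
next
  case False
  with assms have E: "1 < E" by simp
  \<comment> \<open>Interpolation by the chord between the endpoints, minus the exact convexity
    gap.\<close>
  have "(E - 1) * (a + t\<^sup>2 - c * (u + t)\<^sup>2)
      = (E - t) * (a + 1 - c * (u + 1)\<^sup>2) + (t - 1) * (a + E\<^sup>2 - c * (u + E)\<^sup>2)
        - (1 - c) * (E - 1) * ((t - 1) * (E - t))"
    by algebra
  also have "\<dots> \<le> 0"
  proof -
    have "(E - t) * (a + 1 - c * (u + 1)\<^sup>2) \<le> 0" "(t - 1) * (a + E\<^sup>2 - c * (u + E)\<^sup>2) \<le> 0"
      using assms by (auto intro!: mult_nonneg_nonpos)
    moreover have "0 \<le> (1 - c) * (E - 1) * ((t - 1) * (E - t))"
      using assms E by (intro mult_nonneg_nonneg) auto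
    ultimately show ?thesis by linarith
  qed
  finally show ?thesis using E by (simp add: mult_le_0_iff)
qed

text \<open>One coordinate at a time is pushed to 1 or \<open>E\<close> by convexity. The offsets
  \<open>a\<close> and \<open>u\<close> collect the squares and values of the coordinates already
  fixed, hence are generalised in the induction; \<open>T\<close> is the set of coordinates equal to
  \<open>E\<close> at a vertex.\<close>

lemma sum_squares_le_vertices:
  fixes w :: "'a \<Rightarrow> real" and a c u E :: real
  assumes "finite A" "c \<le> 1"
    and "\<And>x. x \<in> A \<Longrightarrow> 1 \<le> w x" "\<And>x. x \<in> A \<Longrightarrow> w x \<le> E"
    and "\<And>T. T \<subseteq> A \<Longrightarrow> a + (card T * E\<^sup>2 + card (A - T)) \<le> c * (u + (card T * E + card (A - T)))\<^sup>2"
  shows "a + (\<Sum>x\<in>A. (w x)\<^sup>2) \<le> c * (u + (\<Sum>x\<in>A. w x))\<^sup>2"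
  using assms(1,3-)
proof (induction A arbitrary: a u rule: finite_induct)
  case empty
  then show ?case using empty.prems(3)[of "{}"] by simp
next
  case (insert x A)
  have 1: "(a + 1) + (\<Sum>x\<in>A. (w x)\<^sup>2) \<le> c * ((u + 1) + (\<Sum>x\<in>A. w x))\<^sup>2"
  proof (rule insert.IH)
    fix T assume T: "T \<subseteq> A"
    then have "x \<notin> T" "insert x A - T = insert x (A - T)" using insert.hyps by auto
    then show "(a + 1) + (card T * E\<^sup>2 + card (A - T)) \<le> c * ((u + 1) + (card T * E + card (A - T)))\<^sup>2"
      using insert.prems(3)[of T] T insert.hyps by (auto simp: algebra_simps)
  qed (use insert.prems in auto)
  have 2: "(a + E\<^sup>2) + (\<Sum>x\<in>A. (w x)\<^sup>2) \<le> c * ((u + E) + (\<Sum>x\<in>A. w x))\<^sup>2"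
  proof (rule insert.IH)
    fix T assume T: "T \<subseteq> A"
    then have "x \<notin> T" "insert x A - insert x T = A - T" "finite T"
      using insert.hyps finite_subset by auto
    then show "(a + E\<^sup>2) + (card T * E\<^sup>2 + card (A - T)) \<le> c * ((u + E) + (card T * E + card (A - T)))\<^sup>2"
      using insert.prems(3)[of "insert x T"] T insert.hyps by (auto simp: algebra_simps)
  qed (use insert.prems in auto)
  have "(a + (\<Sum>x\<in>A. (w x)\<^sup>2)) + (w x)\<^sup>2 \<le> c * ((u + (\<Sum>x\<in>A. w x)) + w x)\<^sup>2"
  proof (rule convex_quadratic_le_endpoints[OF \<open>c \<le> 1\<close>, of _ E])
    show "1 \<le> w x" "w x \<le> E" using insert.prems by auto
  qed (use 1 2 in \<open>simp_all only: add.assoc add.commute add.left_commute\<close>)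
  then show ?case 
    unfolding sum.insert[OF insert.hyps] by (simp only: add.assoc add.commute add.left_commute)
qed

text \<open>The left side is the sum of squares over the squared sum for a vector with
  \<open>j\<close> entries \<open>E\<close> and \<open>v - j\<close> entries 1. On the right,
  \<open>j * (v - j)\<close> over the squared sum is the reciprocal of the function minimised in
  \<open>K_opt\<close>.\<close>

lemma two_level_ratio:
  fixes j v E :: real
  assumes "0 < v" "j * E + v - j \<noteq> 0"
  shows "(j * E\<^sup>2 + v - j) / (j * E + v - j)\<^sup>2 = (1 + j * (v - j) * (E - 1)\<^sup>2 / (j * E + v - j)\<^sup>2) / v"
proof -
  have "v * (j * E\<^sup>2 + v - j) = (j * E + v - j)\<^sup>2 + j * (v - j) * (E - 1)\<^sup>2"
    by algebra
  then have "(j * E\<^sup>2 + v - j) = ((j * E + v - j)\<^sup>2 + j * (v - j) * (E - 1)\<^sup>2) / v"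
    using assms by (simp add: eq_divide_eq mult.commute)
  with assms show ?thesis by (simp add: add_divide_distrib)
qed

text \<open>Dividing by the minimum puts \<open>q\<close> into the cube \<open>[1, exp \<epsilon>]\<^sup>v\<close>, whose vertices are the
  two-level vectors compared in \<open>K_opt\<close>.\<close>

lemma ratio_constrained_sum_squares_le:
  fixes q :: "nat \<Rightarrow> real"
  assumes v: "v \<ge> 2" and \<epsilon>: "\<epsilon> > 0" and k: "k \<in> K_opt v \<epsilon>"
    and q: "\<And>x. x \<in> {1..v} \<Longrightarrow> 0 \<le> q x"
    and ratio: "\<And>x x'. x \<in> {1..v} \<Longrightarrow> x' \<in> {1..v} \<Longrightarrow> q x \<le> exp \<epsilon> * q x'"
    and sum: "(\<Sum>x\<in>{1..v}. q x) = v"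
  shows "(\<Sum>x\<in>{1..v}. (q x)\<^sup>2) \<le> v + real v * real k * (real v - k) * (exp \<epsilon> - 1)\<^sup>2 / (k * exp \<epsilon> + v - k)\<^sup>2"
proof -
  define E where "E = exp \<epsilon>"
  have E: "E > 1" using \<epsilon> by (simp add: E_def)
  define D where "D j = real j * E + v - j" for j :: nat
  \<comment> \<open>Up to the factor \<open>(E - 1)\<^sup>2\<close> this is the reciprocal of the
    objective of \<open>K_opt\<close>, so \<open>k\<close> maximises it.\<close>
  define G where "G j = real j * (real v - j) * (E - 1)\<^sup>2 / (D j)\<^sup>2" for j :: nat
  define c where "c = (1 + G k) / v"
  have kv: "1 \<le> k" "k < v" using k v by (auto simp: K_opt_def)
  have D: "D j > 0" if "j \<le> v" for j
  proof (cases "j = 0")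
    case True then show ?thesis using v by (simp add: D_def)
  next
    case False
    then have "0 < real j * E" using E by simp
    then show ?thesis using that by (simp add: D_def)
  qed
  have G0: "0 \<le> G k" using kv by (auto simp: G_def)
  have GG: "G j \<le> G k" if "j \<le> v" for j
  proof (cases "1 \<le> j \<and> j < v")
    case True
    then have "(D k)\<^sup>2 / (real k * (real v - k)) \<le> (D j)\<^sup>2 / (real j * (real v - j))"
      using k by (auto simp: K_opt_def D_def E_def)
    then have "real j * (real v - j) / (D j)\<^sup>2 \<le> real k * (real v - k) / (D k)\<^sup>2"
      using True kv D[of k] D[of j] by (simp add: field_simps)
    then have "real j * (real v - j) / (D j)\<^sup>2 * (E - 1)\<^sup>2 \<le> real k * (real v - k) / (D k)\<^sup>2 * (E - 1)\<^sup>2"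
      by (rule mult_right_mono) simp
    then show ?thesis by (simp add: G_def)
  next
    case False
    \<comment> \<open>\<open>K_opt\<close> does not compare these values; they belong to constant
      vectors, for which \<open>G\<close> is 0.\<close>
    with that have "j = 0 \<or> j = v" by auto
    then show ?thesis using G0 by (auto simp: G_def)
  qed
  have vert: "j * E\<^sup>2 + v - j \<le> c * (D j)\<^sup>2" if "j \<le> v" for j :: nat
  proof -
    have "(j * E\<^sup>2 + v - j) / (D j)\<^sup>2 = (1 + G j) / v"
      unfolding G_def D_def using D[OF that] v by (intro two_level_ratio) (auto simp: D_def)
    also have "\<dots> \<le> c" using GG[OF that] by (simp add: c_def divide_right_mono)
    finally show ?thesis using D[OF that] by (simp add: divide_le_eq)
  qed
  \<comment> \<open>This is the convexity condition of \<open>sum_squares_le_vertices\<close>. It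
    holds because \<open>c\<close> is the ratio of a sum of squares to a squared sum with
    nonnegative entries.\<close>
  have c1: "c \<le> 1"
  proof -
    have "(k * E\<^sup>2 + v - k) / (D k)\<^sup>2 = c"
      unfolding c_def G_def D_def using D[of k] kv by (intro two_level_ratio) (auto simp: D_def)
    moreover have "k * E\<^sup>2 + v - k \<le> (D k)\<^sup>2"
    proof -
      have "k * E\<^sup>2 \<le> (real k)\<^sup>2 * E\<^sup>2"
        using kv by (intro mult_right_mono) (auto simp: power2_eq_square)
      moreover have "real v - k \<le> (real v - k)\<^sup>2"
        using kv by (simp add: power2_eq_square mult_le_cancel_left1)
      moreover have "0 \<le> k * E * (real v - k)" using kv E by simp
      ultimately show ?thesis by (simp add: D_def power2_eq_square algebra_simps)
    qed
    ultimately show ?thesis using D[of k] kv by (auto simp: divide_le_eq)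
  qed
  define m where "m = Min (q ` {1..v})"
  have fin: "finite (q ` {1..v})" "q ` {1..v} \<noteq> {}" using v by auto
  obtain x0 where x0: "x0 \<in> {1..v}" "q x0 = m" using Min_in[OF fin] by (auto simp: m_def)
  have mle: "m \<le> q x" if "x \<in> {1..v}" for x using that fin by (auto simp: m_def intro!: Min_le)
  \<comment> \<open>If the minimum were 0, the ratio bound would force all of \<open>q\<close> to
    vanish, against its sum being \<open>v\<close>.\<close>
  have m0: "m > 0"
  proof (rule ccontr)
    assume "\<not> m > 0"
    then have "m = 0" using q[OF x0(1)] x0 by simp
    then have "q x = 0" if "x \<in> {1..v}" for x
      using ratio[OF that x0(1)] q[OF that] x0 by simp
    then have "(\<Sum>x\<in>{1..v}. q x) = 0" by simp
    then show False using sum v by simp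
  qed
  have "0 + (\<Sum>x\<in>{1..v}. (q x / m)\<^sup>2) \<le> c * (0 + (\<Sum>x\<in>{1..v}. q x / m))\<^sup>2"
  proof (rule sum_squares_le_vertices[where E = E])
    fix T assume T: "T \<subseteq> {1..v}"
    then have ct: "card T \<le> v" using card_mono[of "{1..v}" T] by simp
    have "card ({1..v} - T) = v - card T" using T by (simp add: card_Diff_subset finite_subset)
    then show "0 + (card T * E\<^sup>2 + card ({1..v} - T)) \<le> c * (0 + (card T * E + card ({1..v} - T)))\<^sup>2"
      using vert[OF ct] ct by (simp add: D_def of_nat_diff algebra_simps)
  qed (use m0 mle ratio x0 c1 in \<open>auto simp: divide_le_eq E_def mult.commute\<close>)
  also have "0 + (\<Sum>x\<in>{1..v}. (q x / m)\<^sup>2) = (\<Sum>x\<in>{1..v}. (q x)\<^sup>2) / m\<^sup>2"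
    by (simp add: power_divide sum_divide_distrib)
  also have "c * (0 + (\<Sum>x\<in>{1..v}. q x / m))\<^sup>2 = c * v\<^sup>2 / m\<^sup>2"
    using sum by (simp add: sum_divide_distrib[symmetric] power_divide)
  finally have "(\<Sum>x\<in>{1..v}. (q x)\<^sup>2) \<le> c * v\<^sup>2"
    using m0 by (simp add: divide_le_cancel)
  also have "\<dots> = v + v * G k" using v by (simp add: c_def power2_eq_square field_simps)
  finally show ?thesis by (simp add: G_def D_def E_def mult.assoc)
qed

subsection \<open>Lower bound for unbiased schemes\<close>

lemma uniform_in_prob_vecs: "1 \<le> v \<Longrightarrow> (\<lambda>_. 1 / real v) \<in> prob_vecs v"
  by (simp add: prob_vecs_def)

text \<open>Each \<open>Q x\<close> has weight \<open>1 / v\<close> in the uniform mixture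
  \<open>M\<close>, so it is dominated by \<open>v\<close> times \<open>M\<close>.\<close>

lemma output_dist_densities:
  assumes mech: "mechanism v Q N" and v: "1 \<le> v"
  defines "M \<equiv> output_dist v (\<lambda>_. 1 / real v) Q"
  obtains q :: "nat \<Rightarrow> 'a \<Rightarrow> real" where
    "\<And>x. x \<in> {1..v} \<Longrightarrow> q x \<in> borel_measurable M"
    "\<And>x y. x \<in> {1..v} \<Longrightarrow> 0 \<le> q x y" "\<And>x y. x \<in> {1..v} \<Longrightarrow> q x y \<le> v"
    "\<And>x. x \<in> {1..v} \<Longrightarrow> Q x = density M (q x)"
proof -
  have U: "(\<lambda>_. 1 / real v) \<in> prob_vecs v" using v by (rule uniform_in_prob_vecs)
  have sM: "sets M = sets N" unfolding M_def by (rule sets_output_dist[OF mech v])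
  have pM: "prob_space M" unfolding M_def by (rule prob_space_output_dist[OF mech U])
  have "\<exists>q :: 'a \<Rightarrow> real. q \<in> borel_measurable M \<and> (\<forall>y. 0 \<le> q y) \<and> (\<forall>y. q y \<le> v) \<and> Q x = density M q"
    if x: "x \<in> {1..v}" for x
  proof -
    have le: "measure (Q x) A \<le> v * measure M A" if "A \<in> sets M" for A
    proof -
      have "measure (Q x) A \<le> (\<Sum>x\<in>{1..v}. measure (Q x) A)"
        using x by (intro member_le_sum) auto
      also have "\<dots> = v * measure M A"
        unfolding M_def using that v sM by (subst measure_output_dist[OF mech U]) (auto simp: sum_divide_distrib[symmetric])
      finally show ?thesis .
    qed
    show ?thesis
      using bounded_density_exists[OF pM, of "Q x" "real v"] le x mech sM unfolding mechanism_def by metis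
  qed
  then show ?thesis using that by metis
qed

lemma integrable_bounded:
  fixes f :: "'a \<Rightarrow> real"
  assumes "prob_space M" "f \<in> borel_measurable M" "\<And>y. \<bar>f y\<bar> \<le> B"
  shows "integrable M f"
proof -
  interpret prob_space M by fact
  show ?thesis using assms by (intro integrable_const_bound[of _ B]) auto
qed

text \<open>The densities satisfy the hypotheses of \<open>ratio_constrained_sum_squares_le\<close>
  almost everywhere: \<open>LDP\<close> gives the ratios, and averaging to \<open>M\<close> gives
  the sum \<open>v\<close>. Integrating the pointwise bound bounds the sum of the chi-square
  divergences of the \<open>Q x\<close> from \<open>M\<close>.\<close>

lemma fisher_information_le:
  fixes q :: "nat \<Rightarrow> 'a \<Rightarrow> real"
  assumes v: "v \<ge> 2" and \<epsilon>: "\<epsilon> > 0" and k: "k \<in> K_opt v \<epsilon>"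
    and mech: "mechanism v Q N" and ldp: "LDP v \<epsilon> Q N"
  defines "M \<equiv> output_dist v (\<lambda>_. 1 / real v) Q"
  assumes q: "\<And>x. x \<in> {1..v} \<Longrightarrow> q x \<in> borel_measurable M"
    "\<And>x y. x \<in> {1..v} \<Longrightarrow> 0 \<le> q x y" "\<And>x y. x \<in> {1..v} \<Longrightarrow> q x y \<le> v"
    "\<And>x. x \<in> {1..v} \<Longrightarrow> Q x = density M (q x)"
  shows "(\<Sum>x\<in>{1..v}. (\<integral>y. (q x y)\<^sup>2 \<partial>M) - 1)
    \<le> real v * real k * (real v - k) * (exp \<epsilon> - 1)\<^sup>2 / (k * exp \<epsilon> + v - k)\<^sup>2"
proof -
  have U: "(\<lambda>_. 1 / real v) \<in> prob_vecs v" using v by (intro uniform_in_prob_vecs) auto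
  have sM: "sets M = sets N" unfolding M_def using v by (intro sets_output_dist[OF mech]) auto
  have pM: "prob_space M" unfolding M_def by (rule prob_space_output_dist[OF mech U])
  interpret M: prob_space M by (rule pM)
  have Iq: "integrable M (q x)" if "x \<in> {1..v}" for x
    using q(1,2,3)[OF that] by (intro integrable_bounded[OF pM, of _ v]) auto
  have Iq2: "integrable M (\<lambda>y. (q x y)\<^sup>2)" if "x \<in> {1..v}" for x
    using q(1,2,3)[OF that] by (intro integrable_bounded[OF pM, of _ "(real v)\<^sup>2"]) (auto intro: power_mono)
  have meas: "measure (Q x) A = (\<integral>y. q x y * indicator A y \<partial>M)" if "x \<in> {1..v}" "A \<in> sets M" for x A
    using that q Iq by (simp add: measure_density_real)
  have ratio: "AE y in M. q x y \<le> exp \<epsilon> * q x' y" if "x \<in> {1..v}" "x' \<in> {1..v}" for x x'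
  proof (rule AE_le_of_set_integral_le)
    fix A assume A: "A \<in> sets M"
    have "measure (Q x) A \<le> exp \<epsilon> * measure (Q x') A"
      using ldp that A sM by (auto simp: LDP_def)
    then show "(\<integral>y. q x y * indicator A y \<partial>M) \<le> (\<integral>y. exp \<epsilon> * q x' y * indicator A y \<partial>M)"
      using that A meas by (simp add: mult.assoc)
  qed (use Iq that in auto)
  have sumq: "(\<integral>y. (\<Sum>x\<in>{1..v}. q x y) * indicator A y \<partial>M) = (\<integral>y. real v * indicator A y \<partial>M)"
    if A: "A \<in> sets M" for A
  proof -
    have "(\<integral>y. (\<Sum>x\<in>{1..v}. q x y) * indicator A y \<partial>M) = (\<Sum>x\<in>{1..v}. measure (Q x) A)"
      unfolding sum_distrib_right using A Iq meas
      by (subst Bochner_Integration.integral_sum) (auto intro: integrable_real_mult_indicator)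
    also have "\<dots> = v * measure M A"
      unfolding M_def using A v sM by (subst measure_output_dist[OF mech U]) (auto simp: sum_divide_distrib[symmetric])
    finally show ?thesis using A by simp
  qed
  have IS: "integrable M (\<lambda>y. \<Sum>x\<in>{1..v}. q x y)"
    using Iq by (intro Bochner_Integration.integrable_sum) auto
  \<comment> \<open>Equal integrals over every set give both one-sided inequalities, hence equality
    almost everywhere.\<close>
  have "AE y in M. (\<Sum>x\<in>{1..v}. q x y) \<le> v" "AE y in M. v \<le> (\<Sum>x\<in>{1..v}. q x y)"
    using AE_le_of_set_integral_le[OF IS, of "\<lambda>_. real v"] AE_le_of_set_integral_le[OF _ IS, of "\<lambda>_. real v"]
      sumq by auto
  moreover have "AE y in M. \<forall>x\<in>{1..v}. \<forall>x'\<in>{1..v}. q x y \<le> exp \<epsilon> * q x' y"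
    using ratio by (intro AE_finite_allI) auto
  ultimately have "AE y in M. (\<Sum>x\<in>{1..v}. (q x y)\<^sup>2)
      \<le> v + real v * real k * (real v - k) * (exp \<epsilon> - 1)\<^sup>2 / (k * exp \<epsilon> + v - k)\<^sup>2" (is "AE y in M. _ \<le> ?B")
    by eventually_elim (rule ratio_constrained_sum_squares_le[OF v \<epsilon> k], use q in auto)
  then have "(\<integral>y. (\<Sum>x\<in>{1..v}. (q x y)\<^sup>2) \<partial>M) \<le> (\<integral>y. ?B \<partial>M)"
    using Iq2 by (intro integral_mono_AE) auto
  then show ?thesis using Iq2 M.prob_space by (simp add: sum_subtractf)
qed

text \<open>A Chapman--Robbins bound at the uniform distribution, for perturbations towards each vertex of
  the simplex; letting the step \<open>t\<close> tend to 0 turns it into a Cramer--Rao bound without ever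
  differentiating under the integral. The free parameter \<open>d\<close> replaces Cauchy--Schwarz.\<close>

lemma unbiased_chapman_robbins:
  fixes q :: "nat \<Rightarrow> 'a \<Rightarrow> real"
  assumes v: "v \<ge> 1" and mech: "mechanism v Q N" and unb: "unbiased v n Q Phat"
  defines "M \<equiv> output_dist v (\<lambda>_. 1 / real v) Q"
  assumes q: "\<And>x. x \<in> {1..v} \<Longrightarrow> q x \<in> borel_measurable M"
    "\<And>x y. x \<in> {1..v} \<Longrightarrow> 0 \<le> q x y" "\<And>x y. x \<in> {1..v} \<Longrightarrow> q x y \<le> v"
    "\<And>x. x \<in> {1..v} \<Longrightarrow> Q x = density M (q x)"
  assumes t: "0 < t" "t \<le> 1"
    and I2: "\<And>x. x \<in> {1..v} \<Longrightarrow> integrable (PiM {..<n} (\<lambda>_. M)) (\<lambda>ys. (Phat ys x - 1 / v)\<^sup>2)"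
  shows "2 * d * (real v - 1) - d\<^sup>2 * (\<Sum>x\<in>{1..v}. ((\<integral>y. (q x y)\<^sup>2 \<partial>M) - 1) *
      (\<Sum>i<n. (1 + t\<^sup>2 * ((\<integral>y. (q x y)\<^sup>2 \<partial>M) - 1)) ^ i))
    \<le> (\<Sum>x\<in>{1..v}. \<integral>ys. (Phat ys x - 1 / v)\<^sup>2 \<partial>PiM {..<n} (\<lambda>_. M))"
proof -
  have U: "(\<lambda>_. 1 / real v) \<in> prob_vecs v" using v by (intro uniform_in_prob_vecs) auto
  have sM: "sets M = sets N" unfolding M_def using v by (intro sets_output_dist[OF mech]) auto
  have pM: "prob_space M" unfolding M_def by (rule prob_space_output_dist[OF mech U])
  interpret M: prob_space M by (rule pM)
  interpret P: product_prob_space "\<lambda>_::nat. M" "{..<n}" by standard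
  let ?Mn = "PiM {..<n} (\<lambda>_. M)"
  have "2 * d * (1 - 1 / real v) - d\<^sup>2 * (((\<integral>y. (q x y)\<^sup>2 \<partial>M) - 1) *
      (\<Sum>i<n. (1 + t\<^sup>2 * ((\<integral>y. (q x y)\<^sup>2 \<partial>M) - 1)) ^ i))
    \<le> (\<integral>ys. (Phat ys x - 1 / v)\<^sup>2 \<partial>?Mn)" if x: "x \<in> {1..v}" for x
  proof -
    note [measurable] = q(1)[OF x]
    have q0: "0 \<le> q x y" and qv: "q x y \<le> v" for y using q x by auto
    have Iq: "integrable M (q x)"
      using q(1,2,3)[OF x] by (intro integrable_bounded[OF pM, of _ v]) auto
    have Iq2: "integrable M (\<lambda>y. (q x y)\<^sup>2)"
      using q(1,2,3)[OF x] by (intro integrable_bounded[OF pM, of _ "(real v)\<^sup>2"]) (auto intro: power_mono)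
    have spx: "prob_space (Q x)" "sets (Q x) = sets M" using mech x sM by (auto simp: mechanism_def)
    have Eq: "(\<integral>y. q x y \<partial>M) = 1"
    proof -
      have "(\<integral>y. q x y \<partial>M) = (\<integral>y. q x y * indicator (space M) y \<partial>M)"
        by (rule Bochner_Integration.integral_cong) auto
      also have "\<dots> = measure (Q x) (space M)"
        using q(4)[OF x] q0 Iq by (simp add: measure_density_real)
      also have "\<dots> = 1"
        using prob_space.prob_space[OF spx(1)] sets_eq_imp_space_eq[OF spx(2)] by simp
      finally show ?thesis .
    qed
    define j where "j = (\<integral>y. (q x y)\<^sup>2 \<partial>M) - 1"
    define g where "g y = (1 - t) + t * q x y" for y
    \<comment> \<open>The uniform vector moved by \<open>t\<close> towards vertex \<open>x\<close>;
      the output law then has density \<open>g\<close> with respect to \<open>M\<close>.\<close>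
    define Pt where "Pt z = (1 - t) / v + (if z = x then t else 0)" for z
    have Pt: "Pt \<in> prob_vecs v"
      using t x v by (auto simp: Pt_def prob_vecs_def sum.distrib)
    have gm [measurable]: "g \<in> borel_measurable M" unfolding g_def by measurable
    have g0: "0 \<le> g y" for y using t q0 by (simp add: g_def)
    have Ig: "integrable M g" and Eg: "integral\<^sup>L M g = 1"
      unfolding g_def using Iq Eq M.prob_space by auto
    have g2: "(g y)\<^sup>2 = (1 - t)\<^sup>2 + 2 * (1 - t) * t * q x y + t\<^sup>2 * (q x y)\<^sup>2" for y
      by (simp add: g_def power2_eq_square algebra_simps)
    have Ig2: "integrable M (\<lambda>y. (g y)\<^sup>2)" unfolding g2 using Iq Iq2 by auto
    have Eg2: "(\<integral>y. (g y)\<^sup>2 \<partial>M) = 1 + t\<^sup>2 * j"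
      unfolding g2 using Iq Iq2 Eq M.prob_space by (simp add: j_def power2_eq_square algebra_simps)
    have out: "output_dist v Pt Q = density M g"
    proof (rule measure_eqI)
      show "sets (output_dist v Pt Q) = sets (density M g)"
        using sets_output_dist[OF mech v] sM by simp
      fix A assume "A \<in> sets (output_dist v Pt Q)"
      then have A: "A \<in> sets N" "A \<in> sets M" using sets_output_dist[OF mech v] sM by auto
      interpret O: prob_space "output_dist v Pt Q" by (rule prob_space_output_dist[OF mech Pt])
      have "measure (output_dist v Pt Q) A = (\<Sum>z\<in>{1..v}. Pt z * measure (Q z) A)"
        by (rule measure_output_dist[OF mech Pt A(1)])
      also have "\<dots> = (\<Sum>z\<in>{1..v}. (1 - t) * (1 / v * measure (Q z) A)) + t * measure (Q x) A"
        using x by (simp add: Pt_def distrib_right sum.distrib if_distrib[of "\<lambda>a. a * _"] cong: if_cong)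
      also have "(\<Sum>z\<in>{1..v}. (1 - t) * (1 / v * measure (Q z) A)) = (1 - t) * measure M A"
        unfolding M_def measure_output_dist[OF mech U A(1)] by (simp only: sum_distrib_left)
      also have "measure (Q x) A = (\<integral>y. q x y * indicator A y \<partial>M)"
        using q(4)[OF x] q0 Iq A by (simp add: measure_density_real)
      also have "(1 - t) * measure M A + t * (\<integral>y. q x y * indicator A y \<partial>M) = (\<integral>y. g y * indicator A y \<partial>M)"
        unfolding g_def distrib_right mult.assoc using A Iq
        by (subst Bochner_Integration.integral_add) (auto simp: M.emeasure_eq_measure intro!: integrable_mult_right integrable_real_mult_indicator)
      also have "\<dots> = measure (density M g) A"
        using g0 Ig A by (simp add: measure_density_real)
      finally have eq: "measure (output_dist v Pt Q) A = measure (density M g) A" .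
      \<comment> \<open>Equality of real-valued measures lifts to \<open>emeasure\<close> only once
        infinite values are excluded, since \<open>measure\<close> maps them to 0.\<close>
      have "emeasure (density M g) A \<noteq> \<infinity>"
      proof -
        have "emeasure (density M g) A \<le> (\<integral>\<^sup>+y. ennreal (g y) \<partial>M)"
          using A by (subst emeasure_density) (auto intro!: nn_integral_mono simp: indicator_def)
        also have "\<dots> = ennreal 1" using Ig g0 Eg by (subst nn_integral_eq_integral) auto
        finally show ?thesis by (auto simp: top_unique)
      qed
      then show "emeasure (output_dist v Pt Q) A = emeasure (density M g) A"
        using eq by (simp add: O.emeasure_eq_measure emeasure_eq_ennreal_measure)
    qed
    define L where "L ys = (\<Prod>i<n. g (ys i))" for ys :: "nat \<Rightarrow> 'a"
    have L0: "0 \<le> L ys" for ys unfolding L_def by (intro prod_nonneg) (auto simp: g0)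
    have Lm [measurable]: "L \<in> borel_measurable ?Mn" unfolding L_def by measurable
    note LR = likelihood_ratio_moments[OF pM Ig Eg Ig2, of n, folded L_def]
    have sd: "sample_dist v n Pt Q = density ?Mn L"
      unfolding sample_dist_def out L_def
      using prob_space_output_dist[OF mech Pt] out g0 by (intro PiM_density_prod[OF pM]) auto
    have uM: "integrable ?Mn (\<lambda>ys. Phat ys x)" "(\<integral>ys. Phat ys x \<partial>?Mn) = 1 / v"
      using unb[unfolded unbiased_def sample_dist_def, rule_format, OF U x] unfolding M_def by blast+
    then have [measurable]: "(\<lambda>ys. Phat ys x) \<in> borel_measurable ?Mn" by auto
    have uP: "integrable (density ?Mn L) (\<lambda>ys. Phat ys x)" "(\<integral>ys. Phat ys x \<partial>density ?Mn L) = Pt x"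
      using unb[unfolded unbiased_def, rule_format, OF Pt x] unfolding sd by blast+
    have uL: "integrable ?Mn (\<lambda>ys. L ys * Phat ys x)" "(\<integral>ys. L ys * Phat ys x \<partial>?Mn) = Pt x"
      using uP L0 by (auto simp: integrable_density integral_density)
    \<comment> \<open>\<open>(L - 1) / t\<close> is a difference quotient in place of the score;
      scaling by \<open>1 / t\<close> keeps the bound nontrivial as \<open>t\<close> tends to
      0.\<close>
    define c where "c = d / t"
    \<comment> \<open>The cross term is grouped so that unbiasedness at \<open>Pt\<close> and at the
      uniform vector evaluates its integral as \<open>Pt x - 1 / v\<close>.\<close>
    have expand: "(Phat ys x - 1 / v - c * (L ys - 1))\<^sup>2 = (Phat ys x - 1 / v)\<^sup>2
        - 2 * c * (L ys * Phat ys x - Phat ys x - 1 / v * (L ys - 1)) + c\<^sup>2 * (L ys - 1)\<^sup>2" for ys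
      by algebra
    have L1: "integral\<^sup>L ?Mn L = 1"
      unfolding L_def using P.product_integral_prod[of "{..<n}" "\<lambda>_. g"] Ig Eg by simp
    have "0 \<le> (\<integral>ys. (Phat ys x - 1 / v - c * (L ys - 1))\<^sup>2 \<partial>?Mn)" by simp
    also have "\<dots> = (\<integral>ys. (Phat ys x - 1 / v)\<^sup>2 \<partial>?Mn) - 2 * c * (Pt x - 1 / v) + c\<^sup>2 * ((1 + t\<^sup>2 * j) ^ n - 1)"
      unfolding expand using I2[OF x] uL uM LR L1 prob_space.prob_space[OF prob_space_PiM[of "{..<n}" "\<lambda>_. M"]] pM
      by (simp add: Eg2)
    also have "Pt x - 1 / v = t * (1 - 1 / v)" by (simp add: Pt_def diff_divide_distrib right_diff_distrib)
    \<comment> \<open>The geometric sum exposes a factor \<open>t\<^sup>2\<close>, which cancels the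
      one in the denominator of \<open>c\<^sup>2\<close>.\<close>
    also have "(1 + t\<^sup>2 * j) ^ n - 1 = t\<^sup>2 * (j * (\<Sum>i<n. (1 + t\<^sup>2 * j) ^ i))"
      by (simp add: power_diff_1_eq)
    finally show ?thesis using t by (simp add: c_def j_def power_divide)
  qed
  note each = this
  have "2 * d * (real v - 1) = (\<Sum>x\<in>{1..v}. 2 * d * (1 - 1 / real v))"
    using v by (simp add: field_simps)
  then show ?thesis
    unfolding sum_distrib_left by (simp only: sum_subtractf[symmetric]) (intro sum_mono each[unfolded sum_distrib_left])
qed

text \<open>The supremum is at least the risk at the uniform vector, to which the Chapman-Robbins
  bound applies. Letting \<open>t\<close> tend to 0 and choosing the best \<open>d\<close> gives
  \<open>(v - 1)\<^sup>2 / (n * J)\<close>.\<close>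

lemma unbiased_LDP_risk_ge:
  assumes v: "v \<ge> 2" and \<epsilon>: "\<epsilon> > 0" and n: "n \<ge> 1" and k: "k \<in> K_opt v \<epsilon>"
    and mech: "mechanism v Q N" and ldp: "LDP v \<epsilon> Q N" and unb: "unbiased v n Q Phat"
  shows "ennreal ((real v - 1)\<^sup>2 * (k * exp \<epsilon> + v - k)\<^sup>2 / (real n * real v * real k * (real v - k) * (exp \<epsilon> - 1)\<^sup>2))
    \<le> risk_l2sq v n Q Phat"
proof -
  define U where "U = (\<lambda>_::nat. 1 / real v)"
  define M where "M = output_dist v U Q"
  let ?Mn = "PiM {..<n} (\<lambda>_. M)"
  define R where "R = (\<integral>\<^sup>+ ys. ennreal (l2sq v U (Phat ys)) \<partial>?Mn)"
  have v1: "1 \<le> v" using v by simp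
  have U: "U \<in> prob_vecs v" unfolding U_def using v1 by (rule uniform_in_prob_vecs)
  have R_le: "R \<le> risk_l2sq v n Q Phat"
    unfolding risk_l2sq_def R_def M_def sample_dist_def[symmetric] by (rule SUP_upper[OF U])
  define J where "J = real v * real k * (real v - k) * (exp \<epsilon> - 1)\<^sup>2 / (k * exp \<epsilon> + v - k)\<^sup>2"
  have kv: "1 \<le> k" "k < v" using k v by (auto simp: K_opt_def)
  have D: "0 < k * exp \<epsilon> + v - k" using kv by (smt (verit) exp_gt_zero mult_pos_pos of_nat_0_less_iff of_nat_less_iff less_le_trans zero_less_one)
  have J: "J > 0" unfolding J_def using kv D \<epsilon> by simp
  show ?thesis
  \<comment> \<open>Infinite risk at the uniform vector settles the claim; finite risk supplies the
    square integrability required below.\<close>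
  proof (cases "R = \<infinity>")
    case True
    with R_le show ?thesis by (simp add: top_unique)
  next
    case False
    have Pm: "(\<lambda>ys. Phat ys x) \<in> borel_measurable ?Mn" if "x \<in> {1..v}" for x
      using unb[unfolded unbiased_def sample_dist_def, rule_format, OF U that, folded M_def] by blast
    have I2: "integrable ?Mn (\<lambda>ys. (Phat ys x - 1 / v)\<^sup>2)" if "x \<in> {1..v}" for x
    proof (rule integrableI_nonneg)
      have "(\<integral>\<^sup>+ ys. ennreal ((Phat ys x - 1 / v)\<^sup>2) \<partial>?Mn) \<le> R"
        unfolding R_def
      proof (intro nn_integral_mono ennreal_leI)
        fix ys
        have "(1 / v - Phat ys x)\<^sup>2 \<le> l2sq v U (Phat ys)"
          unfolding l2sq_def U_def using that
          by (intro member_le_sum[of x "{1..v}" "\<lambda>x. (1 / v - Phat ys x)\<^sup>2"]) auto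
        then show "(Phat ys x - 1 / v)\<^sup>2 \<le> l2sq v U (Phat ys)" by (simp add: power2_commute)
      qed
      also have "R < \<infinity>" using False by (simp add: less_top)
      finally show "(\<integral>\<^sup>+ ys. ennreal ((Phat ys x - 1 / v)\<^sup>2) \<partial>?Mn) < \<infinity>" .
    qed (use Pm[OF that] in auto)
    define S where "S = (\<Sum>x\<in>{1..v}. \<integral>ys. (Phat ys x - 1 / v)\<^sup>2 \<partial>?Mn)"
    have RS: "R = ennreal S"
    proof -
      have "R = ennreal (\<integral>ys. (\<Sum>x\<in>{1..v}. (Phat ys x - 1 / v)\<^sup>2) \<partial>?Mn)"
        unfolding R_def l2sq_def U_def using I2
        by (subst nn_integral_eq_integral[symmetric])
           (auto intro!: nn_integral_cong sum_nonneg simp: power2_commute)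
      then show ?thesis using I2 by (simp add: S_def)
    qed
    obtain q :: "nat \<Rightarrow> 'a \<Rightarrow> real" where q:
      "\<And>x. x \<in> {1..v} \<Longrightarrow> q x \<in> borel_measurable M"
      "\<And>x y. x \<in> {1..v} \<Longrightarrow> 0 \<le> q x y" "\<And>x y. x \<in> {1..v} \<Longrightarrow> q x y \<le> v"
      "\<And>x. x \<in> {1..v} \<Longrightarrow> Q x = density M (q x)"
      using output_dist_densities[OF mech v1] unfolding M_def U_def by blast
    define j where "j x = (\<integral>y. (q x y)\<^sup>2 \<partial>M) - 1" for x
    have jJ: "(\<Sum>x\<in>{1..v}. j x) \<le> J"
      unfolding j_def J_def using q
      by (intro fisher_information_le[OF v \<epsilon> k mech ldp, of q, folded U_def, folded M_def]) auto
    \<comment> \<open>The maximiser of \<open>2 * d * (v - 1) - d\<^sup>2 * n * J\<close>.\<close>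
    define d where "d = (real v - 1) / (n * J)"
    have bound: "2 * d * (real v - 1) - d\<^sup>2 * (\<Sum>x\<in>{1..v}. j x * (\<Sum>i<n. (1 + t\<^sup>2 * j x) ^ i)) \<le> S"
      if "0 < t" "t \<le> 1" for t
      unfolding j_def S_def using q I2 that
      by (intro unbiased_chapman_robbins[OF v1 mech unb, folded U_def, folded M_def]) auto
    \<comment> \<open>As \<open>t\<close> tends to 0 each power tends to 1, so the inner geometric
      sum tends to \<open>n\<close>.\<close>
    have "2 * d * (real v - 1) - d\<^sup>2 * (\<Sum>x\<in>{1..v}. j x * n) \<le> S"
    proof (rule tendsto_upperbound)
      show "((\<lambda>t. 2 * d * (real v - 1) - d\<^sup>2 * (\<Sum>x\<in>{1..v}. j x * (\<Sum>i<n. (1 + t\<^sup>2 * j x) ^ i)))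
          \<longlongrightarrow> 2 * d * (real v - 1) - d\<^sup>2 * (\<Sum>x\<in>{1..v}. j x * n)) (at_right 0)"
        by (auto intro!: tendsto_eq_intros)
      show "\<forall>\<^sub>F t in at_right 0. 2 * d * (real v - 1) - d\<^sup>2 * (\<Sum>x\<in>{1..v}. j x * (\<Sum>i<n. (1 + t\<^sup>2 * j x) ^ i)) \<le> S"
        using eventually_at_right_real[OF zero_less_one] by eventually_elim (rule bound, auto)
    qed simp
    moreover have "d\<^sup>2 * (\<Sum>x\<in>{1..v}. j x * n) \<le> d\<^sup>2 * (J * n)"
      using jJ by (intro mult_left_mono) (auto simp flip: sum_distrib_right intro: mult_right_mono)
    moreover have "2 * d * (real v - 1) - d\<^sup>2 * (J * n) = (real v - 1)\<^sup>2 / (n * J)"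
      using n J by (simp add: d_def power2_eq_square field_simps)
    ultimately have "(real v - 1)\<^sup>2 / (n * J) \<le> S" by linarith
    also have "(real v - 1)\<^sup>2 / (n * J) = (real v - 1)\<^sup>2 * (k * exp \<epsilon> + v - k)\<^sup>2 / (real n * real v * real k * (real v - k) * (exp \<epsilon> - 1)\<^sup>2)"
      by (simp add: J_def mult.assoc)
    finally have "ennreal ((real v - 1)\<^sup>2 * (k * exp \<epsilon> + v - k)\<^sup>2 / (real n * real v * real k * (real v - k) * (exp \<epsilon> - 1)\<^sup>2)) \<le> R"
      unfolding RS by (rule ennreal_leI)
    then show ?thesis using R_le by (rule order_trans)
  qed
qed

subsection \<open>Risk of block design schemes\<close>

text \<open>Double counting: first all incidences, then the pairs \<open>(x, y)\<close> for which
  both \<open>x\<close> and the fixed point 1 are incident with \<open>y\<close>. The pairs with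
  \<open>x = 1\<close> contribute \<open>r\<close>.\<close>

lemma block_design_counting:
  assumes "block_design v b r k lam Y I"
  shows "v * r = b * k" and "lam * (v - 1) = r * (k - 1)"
proof -
  note bd = assms[unfolded block_design_def]
  have finY: "finite Y" and IY: "I \<subseteq> {1..v} \<times> Y" using bd by auto
  have row: "(\<Sum>y\<in>Y. of_bool ((x, y) \<in> I)) = r" if "x \<in> {1..v}" for x
  proof -
    have "Y \<inter> {y. (x, y) \<in> I} = {y. (x, y) \<in> I}" using IY by auto
    then show ?thesis using bd that finY by simp
  qed
  have col: "(\<Sum>x\<in>{1..v}. of_bool ((x, y) \<in> I)) = k" if "y \<in> Y" for y
  proof -
    have "{1..v} \<inter> {x. (x, y) \<in> I} = {x. (x, y) \<in> I}" using IY by auto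
    then show ?thesis using bd that by simp
  qed
  have "v * r = (\<Sum>x\<in>{1..v}. \<Sum>y\<in>Y. of_bool ((x, y) \<in> I))" using row by simp
  also have "\<dots> = (\<Sum>y\<in>Y. \<Sum>x\<in>{1..v}. of_bool ((x, y) \<in> I))" by (rule sum.swap)
  also have "\<dots> = b * k" using col bd by simp
  finally show "v * r = b * k" .
  have "v \<ge> 1" using bd by auto
  then have x1: "(1::nat) \<in> {1..v}" by auto
  have lam: "(\<Sum>y\<in>Y. of_bool ((x, y) \<in> I) * of_bool ((1, y) \<in> I)) = (if x = 1 then r else lam)"
    if "x \<in> {1..v}" for x
  proof -
    have "Y \<inter> {y. (x, y) \<in> I \<and> (1, y) \<in> I} = {y. (x, y) \<in> I} \<inter> {y. (1, y) \<in> I}" using IY by auto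
    then have "(\<Sum>y\<in>Y. of_bool ((x, y) \<in> I \<and> (1, y) \<in> I)) = card ({y. (x, y) \<in> I} \<inter> {y. (1, y) \<in> I})"
      using finY by simp
    then show ?thesis using bd that x1 by (auto simp: of_bool_conj)
  qed
  have "r + (v - 1) * lam = (\<Sum>x\<in>{1..v}. if x = 1 then r else lam)"
  proof -
    have "{1..v} = insert 1 {2..v}" using \<open>v \<ge> 1\<close> by auto
    moreover have "(\<Sum>x\<in>{2..v}. if x = 1 then r else lam) = (\<Sum>x\<in>{2..v}. lam)"
      by (rule sum.cong) auto
    ultimately show ?thesis by simp
  qed
  also have "\<dots> = (\<Sum>x\<in>{1..v}. \<Sum>y\<in>Y. of_bool ((x, y) \<in> I) * of_bool ((1, y) \<in> I))"
    using lam by simp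
  also have "\<dots> = (\<Sum>y\<in>Y. \<Sum>x\<in>{1..v}. of_bool ((x, y) \<in> I) * of_bool ((1, y) \<in> I))"
    by (rule sum.swap)
  also have "\<dots> = (\<Sum>y\<in>Y. k * of_bool ((1, y) \<in> I))"
    using col by (intro sum.cong) (simp_all flip: sum_distrib_right)
  also have "\<dots> = k * r" using row[OF x1] by (simp flip: sum_distrib_left)
  finally have "r + (v - 1) * lam = k * r" .
  \<comment> \<open>The subtraction is on naturals; \<open>k > 0\<close> makes it exact.\<close>
  moreover have "k * r = r + r * (k - 1)" using bd by (cases k) auto
  ultimately show "lam * (v - 1) = r * (k - 1)" by (simp add: mult.commute)
qed

lemma bd_denominator_pos:
  assumes "r < b"
  shows "0 < real r * exp \<epsilon> + real b - real r"
  using assms by (smt (verit) exp_gt_zero mult_nonneg_nonneg of_nat_0_le_iff of_nat_less_iff)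

lemma bd_alpha_pos: "r < b \<Longrightarrow> 0 < bd_alpha b r \<epsilon>"
  unfolding bd_alpha_def by (intro divide_pos_pos bd_denominator_pos) simp_all

lemma measure_point_measure_finite:
  assumes "finite Y" "A \<subseteq> Y" "\<And>y. y \<in> Y \<Longrightarrow> 0 \<le> f y"
  shows "measure (point_measure Y (\<lambda>y. ennreal (f y))) A = (\<Sum>y\<in>A. f y)"
proof -
  have "emeasure (point_measure Y (\<lambda>y. ennreal (f y))) A = (\<Sum>y\<in>A. ennreal (f y))"
    using assms by (intro emeasure_point_measure_finite) auto
  also have "\<dots> = ennreal (\<Sum>y\<in>A. f y)" using assms by (intro sum_ennreal) auto
  moreover have "0 \<le> (\<Sum>y\<in>A. f y)" using assms by (intro sum_nonneg) auto
  ultimately show ?thesis by (simp add: measure_def)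
qed

lemma measure_bd_Q:
  assumes bd: "block_design v b r k lam Y I" and \<epsilon>: "\<epsilon> > 0" and A: "A \<subseteq> Y"
  shows "measure (bd_Q b r \<epsilon> Y I x) A
    = bd_alpha b r \<epsilon> * (card (A \<inter> {y. (x, y) \<in> I}) * exp \<epsilon> + card (A - {y. (x, y) \<in> I}))"
proof -
  have fin: "finite Y" "b > r" using bd by (auto simp: block_design_def)
  then have "finite A" using A finite_subset by auto
  have \<alpha>: "0 \<le> bd_alpha b r \<epsilon>" using bd_alpha_pos[OF fin(2)] by (rule less_imp_le)
  have "measure (bd_Q b r \<epsilon> Y I x) A
      = (\<Sum>y\<in>A. if (x,y) \<in> I then bd_alpha b r \<epsilon> * exp \<epsilon> else bd_alpha b r \<epsilon>)"
    unfolding bd_Q_def using fin A \<alpha> by (intro measure_point_measure_finite) auto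
  also have "\<dots> = bd_alpha b r \<epsilon> * (card (A \<inter> {y. (x, y) \<in> I}) * exp \<epsilon> + card (A - {y. (x, y) \<in> I}))"
    using \<open>finite A\<close> by (simp add: sum.If_cases Diff_eq algebra_simps)
  finally show ?thesis .
qed

lemma mechanism_bd_Q:
  assumes bd: "block_design v b r k lam Y I" and \<epsilon>: "\<epsilon> > 0"
  shows "mechanism v (bd_Q b r \<epsilon> Y I) (count_space Y)"
  unfolding mechanism_def
proof (intro ballI conjI)
  fix x assume x: "x \<in> {1..v}"
  show "sets (bd_Q b r \<epsilon> Y I x) = sets (count_space Y)"
    by (simp add: bd_Q_def sets_point_measure)
  have fin: "finite Y" and br: "b > r" and Ix: "{y. (x, y) \<in> I} \<subseteq> Y" "card {y. (x, y) \<in> I} = r" "card Y = b"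
    using bd x by (auto simp: block_design_def)
  have pos: "0 < real r * exp \<epsilon> + real b - real r" using br by (rule bd_denominator_pos)
  have "Y \<inter> {y. (x, y) \<in> I} = {y. (x, y) \<in> I}" using Ix by auto
  then have "measure (bd_Q b r \<epsilon> Y I x) Y = bd_alpha b r \<epsilon> * (r * exp \<epsilon> + (b - r))"
    using measure_bd_Q[OF bd \<epsilon>, of Y x] Ix fin by (simp add: card_Diff_subset finite_subset)
  also have "\<dots> = 1" using pos br by (simp add: bd_alpha_def of_nat_diff add_diff_eq)
  finally have "measure (bd_Q b r \<epsilon> Y I x) (space (bd_Q b r \<epsilon> Y I x)) = 1"
    by (simp add: bd_Q_def space_point_measure)
  moreover have "finite_measure (bd_Q b r \<epsilon> Y I x)"
    by (rule finite_measureI) (auto simp: bd_Q_def space_point_measure emeasure_point_measure_finite fin)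
  ultimately show "prob_space (bd_Q b r \<epsilon> Y I x)"
    by (intro prob_spaceI) (simp add: finite_measure.emeasure_eq_measure)
qed

text \<open>In coordinate \<open>x\<close> the error is a multiple of a sum of \<open>n\<close>
  independent centred Bernoulli variables, so the loss is a sum of binomial variances. The success
  probabilities add up to \<open>k\<close> because every output lies in exactly \<open>k\<close> of
  the sets \<open>{y. (x, y) \<in> I}\<close>.\<close>

lemma bd_est_expected_loss:
  assumes bd: "block_design v b r k lam Y I" and \<epsilon>: "\<epsilon> > 0" and n: "n \<ge> 1" and P: "P \<in> prob_vecs v"
  defines "c \<equiv> 1 / ((real r - real lam) * (exp \<epsilon> - 1) * bd_alpha b r \<epsilon>)"
    and "M \<equiv> output_dist v P (bd_Q b r \<epsilon> Y I)"
  shows "(\<integral>\<^sup>+ ys. ennreal (l2sq v P (bd_est n b r lam \<epsilon> I ys)) \<partial>sample_dist v n P (bd_Q b r \<epsilon> Y I))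
    = ennreal (\<Sum>x\<in>{1..v}. c\<^sup>2 / n * (measure M {y. (x, y) \<in> I} - (measure M {y. (x, y) \<in> I})\<^sup>2))"
    and "(\<Sum>x\<in>{1..v}. measure M {y. (x, y) \<in> I}) = k"
proof -
  note mech = mechanism_bd_Q[OF bd \<epsilon>]
  have finY: "finite Y" and IXY: "I \<subseteq> {1..v} \<times> Y" and br: "r < b" "lam < r"
    and row: "\<And>x. x \<in> {1..v} \<Longrightarrow> card {y. (x, y) \<in> I} = r"
    and col: "\<And>y. y \<in> Y \<Longrightarrow> card {x. (x, y) \<in> I} = k"
    and pair: "\<And>x z. x \<in> {1..v} \<Longrightarrow> z \<in> {1..v} \<Longrightarrow> x \<noteq> z \<Longrightarrow> card ({y. (x, y) \<in> I} \<inter> {y. (z, y) \<in> I}) = lam"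
    using bd unfolding block_design_def by simp_all
  have v: "1 \<le> v" using P by (rule prob_vecs_imp_pos)
  have pM: "prob_space M" unfolding M_def by (rule prob_space_output_dist[OF mech P])
  interpret M: prob_space M by (rule pM)
  have sM: "sets M = Pow Y" unfolding M_def using sets_output_dist[OF mech v] by simp
  have spM: "space M = Y" using sets_eq_imp_space_eq[of M "count_space Y"] sM by simp
  let ?I = "\<lambda>x. {y. (x, y) \<in> I}"
  define p where "p x = measure M (?I x)" for x
  have IY: "?I x \<subseteq> Y" for x using IXY by auto
  then have Is [measurable]: "?I x \<in> sets M" for x using sM by auto
  have \<alpha>: "0 < bd_alpha b r \<epsilon>" using br(1) by (rule bd_alpha_pos)
  have fin: "finite (?I x)" for x by (rule finite_subset[OF IY finY])
  \<comment> \<open>A baseline common to all inputs plus an excess for the matching input; averaging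
    over \<open>P\<close> therefore makes \<open>p x\<close> affine in \<open>P x\<close>.\<close>
  have QI: "measure (bd_Q b r \<epsilon> Y I z) (?I x)
      = bd_alpha b r \<epsilon> * ((lam * exp \<epsilon> + r - lam) + (if z = x then (real r - lam) * (exp \<epsilon> - 1) else 0))"
    if "x \<in> {1..v}" "z \<in> {1..v}" for x z
  proof -
    have c1: "card (?I x \<inter> ?I z) = (if z = x then r else lam)" using row pair that by auto
    have "card (?I x - ?I z) = r - card (?I x \<inter> ?I z)"
      using card_Diff_subset_Int[of "?I x" "?I z"] fin row[OF that(1)] by simp
    then have c2: "real (card (?I x - ?I z)) = (if z = x then 0 else real r - lam)"
      using c1 br by simp
    show ?thesis
      unfolding measure_bd_Q[OF bd \<epsilon> IY] c1 c2 by (simp add: algebra_simps)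
  qed
  have p_eq: "p x = bd_alpha b r \<epsilon> * ((lam * exp \<epsilon> + r - lam) + P x * ((real r - lam) * (exp \<epsilon> - 1)))"
    if x: "x \<in> {1..v}" for x
  proof -
    have "p x = (\<Sum>z\<in>{1..v}. P z * measure (bd_Q b r \<epsilon> Y I z) (?I x))"
      unfolding p_def M_def using IY by (intro measure_output_dist[OF mech P]) auto
    also have "\<dots> = (\<Sum>z\<in>{1..v}. P z * (bd_alpha b r \<epsilon> * (lam * exp \<epsilon> + r - lam))
        + (if z = x then bd_alpha b r \<epsilon> * (P z * ((real r - lam) * (exp \<epsilon> - 1))) else 0))"
      using x by (intro sum.cong) (auto simp: QI algebra_simps)
    also have "\<dots> = bd_alpha b r \<epsilon> * (lam * exp \<epsilon> + r - lam) + bd_alpha b r \<epsilon> * (P x * ((real r - lam) * (exp \<epsilon> - 1)))"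
      using x P by (simp add: sum.distrib prob_vecs_def flip: sum_distrib_right)
    finally show ?thesis by (simp add: distrib_left)
  qed
  define f where "f x y = indicator (?I x) y - p x" for x y
  have fm [measurable]: "f x \<in> borel_measurable M" for x unfolding f_def by measurable
  have fI: "integrable M (f x)" for x unfolding f_def by (simp add: M.emeasure_eq_measure)
  have f0: "integral\<^sup>L M (f x) = 0" for x
    unfolding f_def using M.prob_space IY spM by (simp add: M.emeasure_eq_measure p_def Int_absorb2)
  have f2: "(f x y)\<^sup>2 = (1 - 2 * p x) * indicator (?I x) y + (p x)\<^sup>2" for x y
    by (auto simp: f_def indicator_def power2_eq_square algebra_simps)
  have f2I: "integrable M (\<lambda>y. (f x y)\<^sup>2)" for x unfolding f2 by (simp add: M.emeasure_eq_measure)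
  have f2E: "(\<integral>y. (f x y)\<^sup>2 \<partial>M) = p x - (p x)\<^sup>2" for x
    unfolding f2 using M.prob_space IY spM
    by (simp add: M.emeasure_eq_measure p_def[symmetric] Int_absorb2 power2_eq_square algebra_simps)
  let ?Mn = "PiM {..<n} (\<lambda>_. M)"
  note sm = second_moment_sum_PiM[OF pM fI f0 f2I, where n = n, unfolded f2E]
  have rl: "(real r - lam) * (exp \<epsilon> - 1) > 0" using br \<epsilon> by simp
  \<comment> \<open>The estimator inverts the affine relation \<open>p_eq\<close> with
    \<open>p x\<close> replaced by the observed frequency.\<close>
  have est: "P x - bd_est n b r lam \<epsilon> I ys x = - (c / n) * (\<Sum>i<n. f x (ys i))" if x: "x \<in> {1..v}" for x ys
  proof -
    have "real (card {i \<in> {..<n}. (x, ys i) \<in> I}) = (\<Sum>i<n. indicator (?I x) (ys i))"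
      by (simp add: indicator_def Int_def sum.If_cases)
    then have N: "real (card {i \<in> {..<n}. (x, ys i) \<in> I}) = (\<Sum>i<n. f x (ys i)) + n * p x"
      by (simp add: f_def sum_subtractf)
    define S a where "S = (\<Sum>i<n. f x (ys i))" and "a = (real r - lam) * (exp \<epsilon> - 1)"
    have "bd_est n b r lam \<epsilon> I ys x = 1 / a * ((S + n * p x) / (n * bd_alpha b r \<epsilon>) - (lam * exp \<epsilon> + r - lam))"
      unfolding bd_est_def Let_def N S_def a_def ..
    also have "\<dots> = c / n * S + P x"
      using rl \<alpha> n unfolding p_eq[OF x] c_def a_def[symmetric] by (simp add: field_simps)
    finally show ?thesis by (simp add: S_def)
  qed
  have loss: "l2sq v P (bd_est n b r lam \<epsilon> I ys) = (\<Sum>x\<in>{1..v}. (c / n)\<^sup>2 * (\<Sum>i<n. f x (ys i))\<^sup>2)" for ys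
    unfolding l2sq_def by (intro sum.cong) (auto simp: est power_mult_distrib power_divide)
  have "(\<integral>\<^sup>+ ys. ennreal (l2sq v P (bd_est n b r lam \<epsilon> I ys)) \<partial>?Mn)
      = ennreal (\<integral>ys. (\<Sum>x\<in>{1..v}. (c / n)\<^sup>2 * (\<Sum>i<n. f x (ys i))\<^sup>2) \<partial>?Mn)"
    unfolding loss using sm(1) by (intro nn_integral_eq_integral) (auto intro!: sum_nonneg)
  also have "(\<integral>ys. (\<Sum>x\<in>{1..v}. (c / n)\<^sup>2 * (\<Sum>i<n. f x (ys i))\<^sup>2) \<partial>?Mn)
      = (\<Sum>x\<in>{1..v}. (c / n)\<^sup>2 * (n * (p x - (p x)\<^sup>2)))"
    using sm by (subst Bochner_Integration.integral_sum) auto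
  also have "\<dots> = (\<Sum>x\<in>{1..v}. c\<^sup>2 / n * (p x - (p x)\<^sup>2))"
    using n by (intro sum.cong) (auto simp: power2_eq_square)
  finally show "(\<integral>\<^sup>+ ys. ennreal (l2sq v P (bd_est n b r lam \<epsilon> I ys)) \<partial>sample_dist v n P (bd_Q b r \<epsilon> Y I))
    = ennreal (\<Sum>x\<in>{1..v}. c\<^sup>2 / n * (measure M (?I x) - (measure M (?I x))\<^sup>2))"
    by (simp only: sample_dist_def M_def p_def)
  have "(\<Sum>x\<in>{1..v}. p x) = (\<Sum>x\<in>{1..v}. \<integral>y. indicator (?I x) y \<partial>M)"
    using IY spM by (simp add: p_def Int_absorb2)
  also have "\<dots> = (\<integral>y. (\<Sum>x\<in>{1..v}. indicator (?I x) y) \<partial>M)"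
    by (subst Bochner_Integration.integral_sum) (auto simp: M.emeasure_eq_measure)
  also have "\<dots> = (\<integral>y. real k \<partial>M)"
  proof (rule Bochner_Integration.integral_cong)
    fix y assume "y \<in> space M"
    then have "card {x. (x, y) \<in> I} = k" using col spM by auto
    moreover have "{1..v} \<inter> {x. (x, y) \<in> I} = {x. (x, y) \<in> I}" using IXY by auto
    ultimately show "(\<Sum>x\<in>{1..v}. indicator (?I x) y) = real k"
      by (simp add: indicator_def sum.If_cases)
  qed simp
  finally show "(\<Sum>x\<in>{1..v}. measure M (?I x)) = k"
    using M.prob_space by (simp add: p_def)
qed

text \<open>Since the \<open>p x\<close> sum to \<open>k\<close>, Cauchy-Schwarz gives a bound
  independent of \<open>P\<close>. The counting identities then eliminate \<open>b\<close>,
  \<open>r\<close> and \<open>lam\<close>.\<close>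

lemma bd_scheme_risk_le:
  assumes bd: "block_design v b r k lam Y I" and \<epsilon>: "\<epsilon> > 0" and n: "n \<ge> 1"
  shows "risk_l2sq v n (bd_Q b r \<epsilon> Y I) (bd_est n b r lam \<epsilon> I)
    \<le> ennreal ((real v - 1)\<^sup>2 * (k * exp \<epsilon> + v - k)\<^sup>2 / (real n * real v * real k * (real v - k) * (exp \<epsilon> - 1)\<^sup>2))"
  unfolding risk_l2sq_def
proof (rule SUP_least)
  fix P assume P: "P \<in> prob_vecs v"
  define c where "c = 1 / ((real r - real lam) * (exp \<epsilon> - 1) * bd_alpha b r \<epsilon>)"
  define p where "p x = measure (output_dist v P (bd_Q b r \<epsilon> Y I)) {y. (x, y) \<in> I}" for x
  note loss = bd_est_expected_loss[OF bd \<epsilon> n P, folded c_def p_def]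
  have bd': "k < v" "0 < k" "r < b" "lam < r" using bd by (auto simp: block_design_def)
  have "(\<Sum>x\<in>{1..v}. c\<^sup>2 / n * (p x - (p x)\<^sup>2)) = c\<^sup>2 / n * (k - (\<Sum>x\<in>{1..v}. (p x)\<^sup>2))"
    unfolding sum_distrib_left[symmetric] sum_subtractf loss(2) ..
  also have "\<dots> \<le> c\<^sup>2 / n * (k - k\<^sup>2 / v)"
  proof -
    have "(\<Sum>x\<in>{1..v}. 1 * p x)\<^sup>2 \<le> (\<Sum>x\<in>{1..v}. 1\<^sup>2) * (\<Sum>x\<in>{1..v}. (p x)\<^sup>2)"
      by (rule Cauchy_Schwarz_ineq_sum)
    then have "k\<^sup>2 / v \<le> (\<Sum>x\<in>{1..v}. (p x)\<^sup>2)"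
      using bd' loss(2) by (simp add: divide_le_eq mult.commute)
    then show ?thesis by (intro mult_left_mono) auto
  qed
  also have "c\<^sup>2 / n * (k - k\<^sup>2 / v)
     = (real v - 1)\<^sup>2 * (k * exp \<epsilon> + v - k)\<^sup>2 / (real n * real v * real k * (real v - k) * (exp \<epsilon> - 1)\<^sup>2)"
  proof -
    define E where "E = exp \<epsilon>"
    define D where "D = k * E + v - k"
    have E: "E > 1" using \<epsilon> by (simp add: E_def)
    have vr: "real v * r = real b * k" using block_design_counting(1)[OF bd] by (metis of_nat_mult)
    have lv: "real lam * (real v - 1) = real r * (real k - 1)"
      using arg_cong[OF block_design_counting(2)[OF bd], of real] bd' by (simp add: of_nat_diff)
    have v1: "real v - 1 > 0" using bd' by simp
    have rl: "(real r - lam) = real r * (real v - k) / (real v - 1)"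
      using lv v1 by (simp add: field_simps)
    have "real r * E + b - r = real r * D / k"
      using vr bd' by (simp add: D_def field_simps)
    then have al: "bd_alpha b r \<epsilon> = k / (real r * D)"
      by (simp add: bd_alpha_def E_def)
    have r0: "real r > 0" using bd' by simp
    \<comment> \<open>The factor \<open>r\<close> in \<open>r - lam\<close> cancels the one in the
      denominator of \<open>bd_alpha\<close>, so only \<open>v\<close>, \<open>k\<close> and
      \<open>E\<close> remain.\<close>
    have c: "c = (real v - 1) * D / (k * (real v - k) * (E - 1))"
      unfolding c_def al rl E_def[symmetric] using r0 v1 by simp
    have "k - k\<^sup>2 / v = k * (real v - k) / v" using bd' by (simp add: field_simps power2_eq_square)
    then have "c\<^sup>2 / n * (k - k\<^sup>2 / v) = (real v - 1)\<^sup>2 * D\<^sup>2 / (k * (real v - k) * (E - 1))\<^sup>2 / n * (k * (real v - k) / v)"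
      by (simp add: c power_divide power_mult_distrib)
    also have "\<dots> = (real v - 1)\<^sup>2 * D\<^sup>2 / (real n * real v * real k * (real v - k) * (E - 1)\<^sup>2)"
      using bd' E by (simp add: power2_eq_square ac_simps)
    finally show ?thesis by (simp add: D_def E_def)
  qed
  finally show "(\<integral>\<^sup>+ ys. ennreal (l2sq v P (bd_est n b r lam \<epsilon> I ys)) \<partial>sample_dist v n P (bd_Q b r \<epsilon> Y I))
    \<le> ennreal ((real v - 1)\<^sup>2 * (k * exp \<epsilon> + v - k)\<^sup>2 / (real n * real v * real k * (real v - k) * (exp \<epsilon> - 1)\<^sup>2))"
    unfolding loss(1) by (rule ennreal_leI)
qed

theorem theorem4:
  fixes v b r k lam n :: nat and \<epsilon> :: real
    and Y :: "'b set" and I :: "(nat \<times> 'b) set"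
    and Q' :: "nat \<Rightarrow> 'c measure" and N :: "'c measure"
    and Phat' :: "(nat \<Rightarrow> 'c) \<Rightarrow> nat \<Rightarrow> real"
  assumes "v \<ge> 2" and "\<epsilon> > 0" and "n \<ge> 1"
    and "block_design v b r k lam Y I"
    and "k \<in> K_opt v \<epsilon>"
    and "mechanism v Q' N" and "LDP v \<epsilon> Q' N"
    and "unbiased v n Q' Phat'"
  shows "risk_l2sq v n (bd_Q b r \<epsilon> Y I) (bd_est n b r lam \<epsilon> I)
         \<le> risk_l2sq v n Q' Phat'"
  using bd_scheme_risk_le[OF assms(4,2,3)] unbiased_LDP_risk_ge[OF assms(1-3,5-8)]
  by (rule order_trans)

end
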